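(* Let $X,Y$ be finite sets. For every function $f:X\times Y\to\{0,1\}$, $$NQ(f)\;\geq\;\tfrac12\log_2 \mathrm{fool}^1(f)+1 .$$
   Context: Fooling sets. A 1-fooling set for $f$ is a set $F\subseteq X\times Y$ such that (1) $f(x,y)=1$ for all $(x,y)\in F$, and (2) for any two distinct $(x,y),(x',y')\in F$, $f(x,y')=0$ or $f(x',y)=0$. $\mathrm{fool}^1(f)$ is the maximal size of a 1-fooling set for $f$ (if it is $0$, read $\log_2 0=-\infty$, so the bound is trivial). Quantum protocols without prior entanglement. Alice receives $x\in X$, Bob receives $y\in Y$. A $q$-qubit protocol ($q\ge 1$) starts in a fixed pure product state (independent of the inputs, unentangled between Alice and Bob) on finite-dimensional registers, some held by Alice and the others by Bob. There is no shared entanglement or shared randomness. There are $q$ rounds. In round $t$, a designated sender (depending only on $t$) applies a unitary, depending on $t$ and on the sender's own input, to all registers the sender currently holds, and then transfers one designated qubit to the other party. The output is the result of measuring the last transferred qubit in the computational basis. Nondeterministic complexity. $NQ(f)$ is the minimal $q$ for which some $q$-qubit protocol without prior entanglement satisfies, for all $(x,y)\in X\times Y$: the probability of output 1 is positive if and only if $f(x,y)=1$. Known characterization (de Wolf). For $f$ not identically $0$, $NQ(f)=\lceil\log_2\mathrm{nrank}(f)\rceil+1$, where $\mathrm{nrank}(f)$ is the minimal rank among all matrices $M$ with rows indexed by $X$ and columns by $Y$, with complex (possibly real) entries, such that $M_{x,y}=0$ if and only if $f(x,y)=0$. *)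

theory Defs
  imports Complex_Main "HOL-Library.FuncSet" "HOL-Library.Extended_Real"
begin

section \<open>Fooling sets\<close>

definition one_fooling_set ::
  "'x set \<Rightarrow> 'y set \<Rightarrow> ('x \<times> 'y \<Rightarrow> nat) \<Rightarrow> ('x \<times> 'y) set \<Rightarrow> bool" where
  "one_fooling_set X Y f F \<longleftrightarrow>
     F \<subseteq> X \<times> Y \<and>
     (\<forall>(x, y)\<in>F. f (x, y) = 1) \<and>
     (\<forall>(x, y)\<in>F. \<forall>(x', y')\<in>F. (x, y) \<noteq> (x', y') \<longrightarrow> f (x, y') = 0 \<or> f (x', y) = 0)"

definition fool1 :: "'x set \<Rightarrow> 'y set \<Rightarrow> ('x \<times> 'y \<Rightarrow> nat) \<Rightarrow> nat" where
  "fool1 X Y f = Max {card F |F. one_fooling_set X Y f F}"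

definition log2_ereal :: "nat \<Rightarrow> ereal" where
  "log2_ereal n = (if n = 0 then - \<infinity> else ereal (log 2 (real n)))"


section \<open>Registers, states and local unitaries\<close>

text \<open>
  Registers are named by natural numbers, and register \<open>r\<close> has dimension \<open>d r\<close>.  The
  computational basis of the space of a set \<open>S\<close> of registers consists of the
  assignments of a basis value to each register in \<open>S\<close>.  Vectors and matrices are given by
  their coefficients in this basis; their values outside it are irrelevant.
\<close>

type_synonym config = "nat \<Rightarrow> nat"

definition configs :: "(nat \<Rightarrow> nat) \<Rightarrow> nat set \<Rightarrow> config set" where
  "configs d S = (\<Pi>\<^sub>E r\<in>S. {..<d r})"

definition unit_vector_on :: "'i set \<Rightarrow> ('i \<Rightarrow> complex) \<Rightarrow> bool" where
  "unit_vector_on K \<psi> \<longleftrightarrow> (\<Sum>c\<in>K. (cmod (\<psi> c))\<^sup>2) = 1"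

definition unitary_on :: "'i set \<Rightarrow> ('i \<Rightarrow> 'i \<Rightarrow> complex) \<Rightarrow> bool" where
  "unitary_on K U \<longleftrightarrow>
     (\<forall>a\<in>K. \<forall>b\<in>K. (\<Sum>c\<in>K. U a c * cnj (U b c)) = (if a = b then 1 else 0)) \<and>
     (\<forall>a\<in>K. \<forall>b\<in>K. (\<Sum>c\<in>K. cnj (U c a) * U c b) = (if a = b then 1 else 0))"

text \<open>The action of \<open>U\<close> on the registers in \<open>S\<close>, tensored with the identity on all others.\<close>

definition apply_on ::
  "(nat \<Rightarrow> nat) \<Rightarrow> nat set \<Rightarrow> (config \<Rightarrow> config \<Rightarrow> complex) \<Rightarrow>
   (config \<Rightarrow> complex) \<Rightarrow> config \<Rightarrow> complex" where
  "apply_on d S U \<psi> c = (\<Sum>b\<in>configs d S. U (restrict c S) b * \<psi> (override_on c b S))"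


section \<open>Quantum protocols without prior entanglement\<close>

datatype party = Alice | Bob

text \<open>
  Rounds are numbered from \<open>0\<close>; in round \<open>t\<close> the register \<open>message t\<close> is
  transferred.  The operations of a party at the rounds where the other one sends are ignored.
\<close>

record ('x, 'y) qprotocol =
  dims :: "nat \<Rightarrow> nat"
  regsA :: "nat set"
  regsB :: "nat set"
  initA :: "config \<Rightarrow> complex"
  initB :: "config \<Rightarrow> complex"
  sender :: "nat \<Rightarrow> party"
  message :: "nat \<Rightarrow> nat"
  opA :: "nat \<Rightarrow> 'x \<Rightarrow> config \<Rightarrow> config \<Rightarrow> complex"
  opB :: "nat \<Rightarrow> 'y \<Rightarrow> config \<Rightarrow> config \<Rightarrow> complex"

text \<open>\<open>held P t p\<close> is the set of registers held by \<open>p\<close> after the first \<open>t\<close> rounds.\<close>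

primrec held :: "('x, 'y) qprotocol \<Rightarrow> nat \<Rightarrow> party \<Rightarrow> nat set" where
  "held P 0 p = (case p of Alice \<Rightarrow> regsA P | Bob \<Rightarrow> regsB P)"
| "held P (Suc t) p =
     (if p = sender P t then held P t p - {message P t} else insert (message P t) (held P t p))"

definition qubit_protocol ::
  "'x set \<Rightarrow> 'y set \<Rightarrow> nat \<Rightarrow> ('x, 'y) qprotocol \<Rightarrow> bool" where
  "qubit_protocol X Y q P \<longleftrightarrow>
     1 \<le> q \<and>
     finite (regsA P) \<and> finite (regsB P) \<and> regsA P \<inter> regsB P = {} \<and>
     (\<forall>r\<in>regsA P \<union> regsB P. 1 \<le> dims P r) \<and>
     unit_vector_on (configs (dims P) (regsA P)) (initA P) \<and>
     unit_vector_on (configs (dims P) (regsB P)) (initB P) \<and>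
     (\<forall>t<q. message P t \<in> held P t (sender P t) \<and> dims P (message P t) = 2) \<and>
     (\<forall>t<q. sender P t = Alice \<longrightarrow>
        (\<forall>x\<in>X. unitary_on (configs (dims P) (held P t Alice)) (opA P t x))) \<and>
     (\<forall>t<q. sender P t = Bob \<longrightarrow>
        (\<forall>y\<in>Y. unitary_on (configs (dims P) (held P t Bob)) (opB P t y)))"

text \<open>The global state after the first \<open>t\<close> rounds, as a vector over all registers.\<close>

primrec state :: "('x, 'y) qprotocol \<Rightarrow> 'x \<Rightarrow> 'y \<Rightarrow> nat \<Rightarrow> config \<Rightarrow> complex" where
  "state P x y 0 = (\<lambda>c. initA P (restrict c (regsA P)) * initB P (restrict c (regsB P)))"
| "state P x y (Suc t) =
     apply_on (dims P) (held P t (sender P t))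
       (case sender P t of Alice \<Rightarrow> opA P t x | Bob \<Rightarrow> opB P t y) (state P x y t)"

definition prob_output_1 :: "('x, 'y) qprotocol \<Rightarrow> nat \<Rightarrow> 'x \<Rightarrow> 'y \<Rightarrow> real" where
  "prob_output_1 P q x y =
     (\<Sum>c\<in>{c \<in> configs (dims P) (regsA P \<union> regsB P). c (message P (q - 1)) = 1}.
        (cmod (state P x y q c))\<^sup>2)"


section \<open>Nondeterministic quantum communication complexity\<close>

text \<open>The minimal \<open>q\<close>, with the minimum of the empty set read as \<open>\<infinity>\<close>.\<close>

definition NQ :: "'x set \<Rightarrow> 'y set \<Rightarrow> ('x \<times> 'y \<Rightarrow> nat) \<Rightarrow> enat" where
  "NQ X Y f = Inf {enat q |q. \<exists>P. qubit_protocol X Y q P \<and>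
     (\<forall>x\<in>X. \<forall>y\<in>Y. 0 < prob_output_1 P q x y \<longleftrightarrow> f (x, y) = 1)}"


end

theory Submission
  imports Defs
begin

text \<open>
  As in the arguments of Yao and Kremer, each transferred qubit at most doubles the number of
  product terms in the global state.  The last transfer need not be counted, since the output
  depends only on the value of the transferred qubit: the accepting amplitudes are sums of
  \<open>2 ^ (q - 1)\<close> products.  For a fooling set choose for each of its elements
  \<open>k = (x\<^sub>k, y\<^sub>k)\<close> an accepting configuration \<open>c\<^sub>k\<close> of nonzero amplitude, and let \<open>M\<^sub>k\<^sub>l\<close> be
  the amplitude on inputs \<open>(x\<^sub>k, y\<^sub>l)\<close> of the configuration that agrees with \<open>c\<^sub>k\<close> on Alice's side
  and with \<open>c\<^sub>l\<close> on Bob's.  This avoids passing from vectors of amplitudes to a single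
  nondeterministic matrix.  The entrywise product of \<open>M\<close> and its transpose is diagonal with nonzero
  diagonal and has rank at most \<open>(2 ^ (q - 1))\<^sup>2\<close>.
\<close>

section \<open>Linear algebra\<close>

text \<open>Gaussian elimination. A trivial equation is dropped; an equation \<open>p\<close> with
  nonzero coefficient at some unknown \<open>m\<close> is solved for \<open>m\<close> and
  substituted into the others, which costs one equation and one unknown.\<close>

lemma underdetermined_system_nontrivial_solution:
  fixes w :: "'p \<Rightarrow> 'k \<Rightarrow> 'a::field"
  assumes "finite P" and "finite F" and "card P < card F"
  shows "\<exists>c. (\<exists>l\<in>F. c l \<noteq> 0) \<and> (\<forall>p\<in>P. (\<Sum>l\<in>F. w p l * c l) = 0)"
  using assms
proof (induction P arbitrary: F w rule: finite_induct)
  case empty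
  then obtain l where "l \<in> F" by fastforce
  then show ?case by (intro exI[of _ "\<lambda>_. 1"]) auto
next
  case (insert p P)
  show ?case
  proof (cases "\<forall>l\<in>F. w p l = 0")
    case True
    have "card P < card F" using insert by simp
    from insert.IH[OF insert.prems(1) this, of w] show ?thesis
      using True by auto
  next
    case False
    then obtain m where m: "m \<in> F" "w p m \<noteq> 0" by blast
    define G where "G = F - {m}"
    have G: "finite G" "card P < card G" "m \<notin> G" "F = insert m G"
      using insert m by (auto simp: G_def)
    obtain c where c: "\<exists>l\<in>G. c l \<noteq> 0"
      and eq: "\<And>s. s \<in> P \<Longrightarrow> (\<Sum>l\<in>G. (w s l - w s m * w p l / w p m) * c l) = 0"
      using insert.IH[OF G(1,2), of "\<lambda>s l. w s l - w s m * w p l / w p m"] by blast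
    \<comment> \<open>The value at \<open>m\<close> is the one that equation \<open>p\<close>
      forces.\<close>
    define c' where "c' = c(m := - (\<Sum>l\<in>G. w p l * c l) / w p m)"
    have sum: "(\<Sum>l\<in>F. w s l * c' l)
        = (\<Sum>l\<in>G. w s l * c l) - w s m * (\<Sum>l\<in>G. w p l * c l) / w p m" for s
    proof -
      have "(\<Sum>l\<in>G. w s l * c' l) = (\<Sum>l\<in>G. w s l * c l)"
        using G(3) by (intro sum.cong) (auto simp: c'_def)
      then show ?thesis using G by (simp add: c'_def)
    qed
    have "(\<Sum>l\<in>F. w s l * c' l) = 0" if "s \<in> P" for s
      using eq[OF that] unfolding sum
      by (simp add: left_diff_distrib sum_subtractf sum_distrib_left sum_divide_distrib mult.assoc)
    moreover have "(\<Sum>l\<in>F. w p l * c' l) = 0"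
      unfolding sum using m by simp
    moreover have "\<exists>l\<in>F. c' l \<noteq> 0"
      using c G by (auto simp: c'_def)
    ultimately show ?thesis by blast
  qed
qed

text \<open>With fewer than \<open>card F\<close> indices in \<open>P\<close>, the factor
  \<open>w\<close> annihilates a nonzero vector \<open>c\<close>, hence so does the product matrix;
  but a diagonal matrix with nonzero diagonal is injective.\<close>

lemma diagonal_rank_bound:
  fixes u w :: "'p \<Rightarrow> 'k \<Rightarrow> 'a::field"
  assumes "finite P" and "finite F"
    and diag: "\<And>k. k \<in> F \<Longrightarrow> (\<Sum>p\<in>P. u p k * w p k) \<noteq> 0"
    and off: "\<And>k l. k \<in> F \<Longrightarrow> l \<in> F \<Longrightarrow> k \<noteq> l \<Longrightarrow> (\<Sum>p\<in>P. u p k * w p l) = 0"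
  shows "card F \<le> card P"
proof (rule ccontr)
  assume "\<not> card F \<le> card P"
  then obtain c k where k: "k \<in> F" "c k \<noteq> 0"
    and c: "\<And>p. p \<in> P \<Longrightarrow> (\<Sum>l\<in>F. w p l * c l) = 0"
    using underdetermined_system_nontrivial_solution[of P F w] assms(1,2) by auto
  have "0 = (\<Sum>p\<in>P. u p k * (\<Sum>l\<in>F. w p l * c l))" using c by simp
  also have "\<dots> = (\<Sum>l\<in>F. (\<Sum>p\<in>P. u p k * w p l) * c l)"
    unfolding sum_distrib_left sum_distrib_right by (subst sum.swap) (simp add: mult.assoc)
  also have "\<dots> = (\<Sum>l\<in>F. if l = k then (\<Sum>p\<in>P. u p k * w p k) * c k else 0)"
    using off k by (intro sum.cong) auto
  also have "\<dots> = (\<Sum>p\<in>P. u p k * w p k) * c k" using k assms(2) by simp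
  finally show False using diag k by simp
qed

lemma fooling_matrix_rank_bound:
  fixes a b :: "'i \<Rightarrow> 'k \<Rightarrow> 'a::field"
  assumes "finite I" and "finite F"
    and diag: "\<And>k. k \<in> F \<Longrightarrow> (\<Sum>i\<in>I. a i k * b i k) \<noteq> 0"
    and off: "\<And>k l. k \<in> F \<Longrightarrow> l \<in> F \<Longrightarrow> k \<noteq> l \<Longrightarrow>
      (\<Sum>i\<in>I. a i k * b i l) = 0 \<or> (\<Sum>i\<in>I. a i l * b i k) = 0"
  shows "card F \<le> (card I)\<^sup>2"
proof -
  \<comment> \<open>In the product of the entries \<open>(k, l)\<close> and \<open>(l, k)\<close>,
    the factors depending on \<open>k\<close> are separated from those depending on
    \<open>l\<close>; pairs of summation indices then index a factorization.\<close>
  have hadamard: "(\<Sum>p\<in>I \<times> I. (a (fst p) k * b (snd p) k) * (b (fst p) l * a (snd p) l))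
      = (\<Sum>i\<in>I. a i k * b i l) * (\<Sum>i\<in>I. a i l * b i k)" for k l
    unfolding sum_product sum.cartesian_product
    by (intro sum.cong) (auto simp: mult_ac)
  have "card F \<le> card (I \<times> I)"
    by (rule diagonal_rank_bound[where u = "\<lambda>p k. a (fst p) k * b (snd p) k"
          and w = "\<lambda>p l. b (fst p) l * a (snd p) l"])
      (use assms in \<open>auto simp: hadamard\<close>)
  then show ?thesis by (simp add: card_cartesian_product power2_eq_square)
qed


section \<open>Sums of product states\<close>

text \<open>Bounds the tensor rank across the cut between \<open>S\<close> and \<open>T\<close>,
  uniformly in the inputs: left factors see only \<open>x\<close>, right factors only
  \<open>y\<close>.\<close>

definition product_terms ::
  "config set \<Rightarrow> nat set \<Rightarrow> nat set \<Rightarrow> nat \<Rightarrow> ('x \<Rightarrow> 'y \<Rightarrow> config \<Rightarrow> complex) \<Rightarrow> bool" where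
  "product_terms K S T n \<psi> \<longleftrightarrow> (\<exists>\<alpha> \<beta>. \<forall>x y. \<forall>c\<in>K.
     \<psi> x y c = (\<Sum>i<n. \<alpha> i x (restrict c S) * \<beta> i y (restrict c T)))"

text \<open>Reduces rounds in which Bob sends to those in which Alice sends.\<close>

lemma product_terms_swap:
  assumes "product_terms K S T n \<psi>"
  shows "product_terms K T S n (\<lambda>y x. \<psi> x y)"
proof -
  obtain \<alpha> \<beta> where "\<forall>x y. \<forall>c\<in>K.
      \<psi> x y c = (\<Sum>i<n. \<alpha> i x (restrict c S) * \<beta> i y (restrict c T))"
    using assms unfolding product_terms_def by blast
  then show ?thesis unfolding product_terms_def
    by (intro exI[of _ \<beta>] exI[of _ \<alpha>]) (simp add: mult.commute)
qed

text \<open>By linearity the operator is absorbed into the left factors, while the right factors do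
  not see the registers in \<open>S\<close>; the number of terms stays the same.\<close>

lemma product_terms_apply_on:
  assumes "product_terms (configs d R) S T n \<psi>" and "S \<subseteq> R" and "S \<inter> T = {}"
  shows "product_terms (configs d R) S T n (\<lambda>x y. apply_on d S (U x) (\<psi> x y))"
proof -
  obtain \<alpha> \<beta> where \<psi>: "\<And>x y c. c \<in> configs d R \<Longrightarrow>
      \<psi> x y c = (\<Sum>i<n. \<alpha> i x (restrict c S) * \<beta> i y (restrict c T))"
    using assms unfolding product_terms_def by blast
  have "apply_on d S (U x) (\<psi> x y) c
      = (\<Sum>i<n. (\<Sum>b\<in>configs d S. U x (restrict c S) b * \<alpha> i x b) * \<beta> i y (restrict c T))"
    if c: "c \<in> configs d R" for x y c
  proof -
    have "\<psi> x y (override_on c b S) = (\<Sum>i<n. \<alpha> i x b * \<beta> i y (restrict c T))"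
      if b: "b \<in> configs d S" for b
    proof -
      have "override_on c b S \<in> configs d R"
        using b c \<open>S \<subseteq> R\<close> by (auto simp: configs_def override_on_def PiE_iff extensional_def)
      moreover have "restrict (override_on c b S) S = b"
        using b by (auto simp: configs_def override_on_def PiE_iff extensional_def fun_eq_iff)
      moreover have "restrict (override_on c b S) T = restrict c T"
        using \<open>S \<inter> T = {}\<close> by (auto simp: override_on_def fun_eq_iff)
      ultimately show ?thesis using \<psi> by simp
    qed
    then have "apply_on d S (U x) (\<psi> x y) c
        = (\<Sum>b\<in>configs d S. \<Sum>i<n. U x (restrict c S) b * (\<alpha> i x b * \<beta> i y (restrict c T)))"
      unfolding apply_on_def by (simp add: sum_distrib_left)
    then show ?thesis
      by (subst (asm) sum.swap) (simp add: sum_distrib_right mult.assoc)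
  qed
  then show ?thesis unfolding product_terms_def
    by (intro exI[of _ "\<lambda>i x a. \<Sum>b\<in>configs d S. U x a b * \<alpha> i x b"] exI[of _ \<beta>]) blast
qed

lemma sum_div_mod_2:
  fixes g :: "nat \<Rightarrow> nat \<Rightarrow> 'a::comm_monoid_add"
  shows "(\<Sum>j<2 * n. g (j div 2) (j mod 2)) = (\<Sum>i<n. g i 0 + g i 1)"
  by (induction n) (simp_all add: add.assoc)

text \<open>Each term is split according to the value of the qubit \<open>r\<close>: the left factor
  has this value fixed, and the right factor, which now reads \<open>r\<close>, checks it.\<close>

lemma product_terms_transfer:
  assumes "product_terms (configs d R) S T n \<psi>"
    and "r \<in> S" and "S \<subseteq> R" and "d r = 2"
  shows "product_terms (configs d R) (S - {r}) (insert r T) (2 * n) \<psi>"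
proof -
  obtain \<alpha> \<beta> where \<psi>: "\<And>x y c. c \<in> configs d R \<Longrightarrow>
      \<psi> x y c = (\<Sum>i<n. \<alpha> i x (restrict c S) * \<beta> i y (restrict c T))"
    using assms unfolding product_terms_def by blast
  \<comment> \<open>The index \<open>j\<close> encodes the old term \<open>j div 2\<close> and the
    guessed value \<open>j mod 2\<close> of \<open>r\<close>.\<close>
  define \<alpha>' where "\<alpha>' = (\<lambda>j x a. \<alpha> (j div 2) x (a(r := j mod 2)))"
  define \<beta>' where
    "\<beta>' = (\<lambda>j y b. if b r = j mod 2 then \<beta> (j div 2) y (restrict b T) else 0)"
  have "\<psi> x y c
      = (\<Sum>j<2 * n. \<alpha>' j x (restrict c (S - {r})) * \<beta>' j y (restrict c (insert r T)))"
    if c: "c \<in> configs d R" for x y c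
  proof -
    have "c r < d r" using c assms(2,3) by (auto simp: configs_def PiE_iff)
    then have r: "c r = 0 \<or> c r = 1" using \<open>d r = 2\<close> by auto
    define a where "a = restrict c (S - {r})"
    define b where "b = restrict c (insert r T)"
    have upd: "a(r := c r) = restrict c S"
      using \<open>r \<in> S\<close> by (auto simp: a_def fun_eq_iff)
    have b: "b r = c r" "restrict b T = restrict c T"
      by (auto simp: b_def fun_eq_iff)
    have "(\<Sum>j<2 * n. \<alpha>' j x a * \<beta>' j y b) = (\<Sum>i<n. \<alpha> i x (a(r := 0)) *
        (if b r = 0 then \<beta> i y (restrict b T) else 0) +
        \<alpha> i x (a(r := 1)) * (if b r = 1 then \<beta> i y (restrict b T) else 0))"
      unfolding \<alpha>'_def \<beta>'_def
      by (rule sum_div_mod_2[where g = "\<lambda>i z. \<alpha> i x (a(r := z)) *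
            (if b r = z then \<beta> i y (restrict b T) else 0)"])
    also have "\<dots> = (\<Sum>i<n. \<alpha> i x (restrict c S) * \<beta> i y (restrict c T))"
      using r upd by (auto simp: b)
    finally have "(\<Sum>j<2 * n. \<alpha>' j x a * \<beta>' j y b)
        = (\<Sum>i<n. \<alpha> i x (restrict c S) * \<beta> i y (restrict c T))" .
    then show ?thesis using \<psi> c by (simp add: a_def b_def)
  qed
  then show ?thesis unfolding product_terms_def by blast
qed


section \<open>States of protocols\<close>

lemma held_partition:
  assumes "qubit_protocol X Y q P" and "t \<le> q"
  shows "held P t Alice \<union> held P t Bob = regsA P \<union> regsB P \<and>
    held P t Alice \<inter> held P t Bob = {}"
  using assms(2)
proof (induction t)
  case 0
  then show ?case using assms(1) by (simp add: qubit_protocol_def)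
next
  case (Suc t)
  then have "message P t \<in> held P t (sender P t)"
    using assms(1) by (simp add: qubit_protocol_def)
  with Suc show ?case by (cases "sender P t") auto
qed

text \<open>A transfer alters only \<open>held\<close>, not the state vector. Relative to the
  ownership before the transfer, a round is thus just a local operation and adds no terms.\<close>

lemma product_terms_local_step:
  assumes "qubit_protocol X Y q P" and "t \<le> q"
    and "product_terms (configs (dims P) (regsA P \<union> regsB P)) (held P t Alice) (held P t Bob) n
      (\<lambda>x y. state P x y t)"
  shows "product_terms (configs (dims P) (regsA P \<union> regsB P)) (held P t Alice) (held P t Bob) n
      (\<lambda>x y. state P x y (Suc t))"
proof (cases "sender P t")
  case Alice
  then show ?thesis
    using product_terms_apply_on[OF assms(3), of "opA P t"] held_partition[OF assms(1,2)] by auto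
next
  case Bob
  then show ?thesis
    using product_terms_swap[OF product_terms_apply_on[OF product_terms_swap[OF assms(3)],
        of "opB P t"]] held_partition[OF assms(1,2)]
    by auto
qed

lemma product_terms_state:
  assumes "qubit_protocol X Y q P" and "t \<le> q"
  shows "product_terms (configs (dims P) (regsA P \<union> regsB P)) (held P t Alice) (held P t Bob)
    (2 ^ t) (\<lambda>x y. state P x y t)"
  using assms(2)
proof (induction t)
  case 0
  show ?case unfolding product_terms_def
    by (intro exI[of _ "\<lambda>_ _. initA P"] exI[of _ "\<lambda>_ _. initB P"]) simp
next
  case (Suc t)
  let ?K = "configs (dims P) (regsA P \<union> regsB P)"
  have m: "message P t \<in> held P t (sender P t)" "dims P (message P t) = 2"
    using Suc.prems assms(1) by (auto simp: qubit_protocol_def)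
  have part: "held P t Alice \<subseteq> regsA P \<union> regsB P" "held P t Bob \<subseteq> regsA P \<union> regsB P"
    using held_partition[OF assms(1), of t] Suc.prems by auto
  have step: "product_terms ?K (held P t Alice) (held P t Bob) (2 ^ t)
      (\<lambda>x y. state P x y (Suc t))"
    using product_terms_local_step[OF assms(1)] Suc by simp
  show ?case
  proof (cases "sender P t")
    case Alice
    then show ?thesis
      using product_terms_transfer[OF step, of "message P t"] m part by (simp del: state.simps)
  next
    case Bob
    then show ?thesis
      using product_terms_swap[OF product_terms_transfer[OF product_terms_swap[OF step],
          of "message P t"]] m part
      by (simp del: state.simps)
  qed
qed

text \<open>The cut is taken before the last transfer, so only \<open>q - 1\<close> transfers double
  the number of terms.\<close>

lemma product_terms_final_state:
  assumes "qubit_protocol X Y q P"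
  shows "product_terms (configs (dims P) (regsA P \<union> regsB P))
    (held P (q - 1) Alice) (held P (q - 1) Bob) (2 ^ (q - 1)) (\<lambda>x y. state P x y q)"
proof -
  have "1 \<le> q" using assms by (simp add: qubit_protocol_def)
  then show ?thesis
    using product_terms_local_step[OF assms _ product_terms_state[OF assms], of "q - 1"]
    by (simp del: state.simps)
qed


section \<open>Fooling sets\<close>

lemma prob_output_1_pos_iff:
  assumes "qubit_protocol X Y q P"
  shows "0 < prob_output_1 P q x y \<longleftrightarrow>
    (\<exists>c\<in>configs (dims P) (regsA P \<union> regsB P). c (message P (q - 1)) = 1 \<and> state P x y q c \<noteq> 0)"
proof -
  let ?C = "{c \<in> configs (dims P) (regsA P \<union> regsB P). c (message P (q - 1)) = 1}"
  have "finite ?C"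
    using assms by (auto simp: qubit_protocol_def configs_def intro!: finite_PiE)
  then have "prob_output_1 P q x y = 0 \<longleftrightarrow> (\<forall>c\<in>?C. state P x y q c = 0)"
    unfolding prob_output_1_def by (subst sum_nonneg_eq_0_iff) auto
  moreover have "0 \<le> prob_output_1 P q x y"
    unfolding prob_output_1_def by (simp add: sum_nonneg)
  ultimately show ?thesis by (auto simp: less_le)
qed

lemma fooling_set_card_le:
  assumes P: "qubit_protocol X Y q P"
    and acc: "\<forall>x\<in>X. \<forall>y\<in>Y. 0 < prob_output_1 P q x y \<longleftrightarrow> f (x, y) = 1"
    and "finite F" and F: "one_fooling_set X Y f F"
  shows "card F \<le> (2 ^ (q - 1))\<^sup>2"
proof -
  define n :: nat where "n = 2 ^ (q - 1)"
  define K where "K = configs (dims P) (regsA P \<union> regsB P)"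
  define S where "S = held P (q - 1) Alice"
  define T where "T = held P (q - 1) Bob"
  have ST: "S \<union> T = regsA P \<union> regsB P" "S \<inter> T = {}"
    using held_partition[OF P, of "q - 1"] by (auto simp: S_def T_def)
  obtain \<alpha> \<beta> where \<psi>: "\<And>x y c. c \<in> K \<Longrightarrow>
      state P x y q c = (\<Sum>i<n. \<alpha> i x (restrict c S) * \<beta> i y (restrict c T))"
    using product_terms_final_state[OF P]
    unfolding product_terms_def K_def S_def T_def n_def by blast
  have "\<forall>k\<in>F. \<exists>c\<in>K. c (message P (q - 1)) = 1 \<and> state P (fst k) (snd k) q c \<noteq> 0"
    using F acc prob_output_1_pos_iff[OF P] by (fastforce simp: one_fooling_set_def K_def)
  then obtain c where c: "\<And>k. k \<in> F \<Longrightarrow> c k \<in> K"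
      "\<And>k. k \<in> F \<Longrightarrow> c k (message P (q - 1)) = 1"
      "\<And>k. k \<in> F \<Longrightarrow> state P (fst k) (snd k) q (c k) \<noteq> 0"
    by metis
  define a where "a = (\<lambda>i k. \<alpha> i (fst k) (restrict (c k) S))"
  define b where "b = (\<lambda>i k. \<beta> i (snd k) (restrict (c k) T))"
  have entry: "(\<Sum>i<n. a i k * b i l) = 0"
    if "k \<in> F" "l \<in> F" and 0: "f (fst k, snd l) = 0" for k l
  proof -
    \<comment> \<open>The hybrid of \<open>c k\<close> on Alice's side and \<open>c l\<close> on
      Bob's. Both assign 1 to the output qubit, so \<open>e\<close> is accepting whichever side
      contains it, and its amplitude must vanish when \<open>f\<close> is 0.\<close>
    define e where "e = override_on (c l) (c k) S"
    have e: "e \<in> K" "e (message P (q - 1)) = 1"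
      using c that by (auto simp: e_def K_def configs_def override_on_def PiE_iff extensional_def)
    have "restrict e S = restrict (c k) S" "restrict e T = restrict (c l) T"
      using ST by (auto simp: e_def override_on_def fun_eq_iff)
    then have "state P (fst k) (snd l) q e = (\<Sum>i<n. a i k * b i l)"
      using \<psi>[OF e(1)] by (simp add: a_def b_def)
    moreover have "fst k \<in> X" "snd l \<in> Y"
      using F that by (auto simp: one_fooling_set_def)
    ultimately show ?thesis
      using acc 0 e prob_output_1_pos_iff[OF P] unfolding K_def by fastforce
  qed
  have "card F \<le> (card {..<n})\<^sup>2"
  proof (rule fooling_matrix_rank_bound[where a = a and b = b])
    show "(\<Sum>i<n. a i k * b i k) \<noteq> 0" if "k \<in> F" for k
      using c[OF that] \<psi> by (simp add: a_def b_def)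
    show "(\<Sum>i<n. a i k * b i l) = 0 \<or> (\<Sum>i<n. a i l * b i k) = 0"
      if "k \<in> F" "l \<in> F" "k \<noteq> l" for k l
    proof -
      have "f (fst k, snd l) = 0 \<or> f (fst l, snd k) = 0"
        using F that unfolding one_fooling_set_def by (cases k, cases l) fastforce
      then show ?thesis using entry that by blast
    qed
  qed (use \<open>finite F\<close> in auto)
  then show ?thesis by (simp add: n_def)
qed

text \<open>The maximum ranges over a finite nonempty set: fooling sets are subsets of
  \<open>X \<times> Y\<close>, and the empty set is one.\<close>

lemma fool1_attained:
  assumes "finite X" and "finite Y"
  obtains F where "one_fooling_set X Y f F" and "finite F" and "card F = fool1 X Y f"
proof -
  have *: "{card F |F. one_fooling_set X Y f F} = card ` {F. one_fooling_set X Y f F}"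
    by auto
  have sub: "{F. one_fooling_set X Y f F} \<subseteq> Pow (X \<times> Y)"
    by (auto simp: one_fooling_set_def)
  then have "finite {F. one_fooling_set X Y f F}"
    using assms by (meson finite_Pow_iff finite_SigmaI finite_subset)
  moreover have "one_fooling_set X Y f {}"
    by (simp add: one_fooling_set_def)
  ultimately have "fool1 X Y f \<in> card ` {F. one_fooling_set X Y f F}"
    unfolding fool1_def * by (intro Max_in) auto
  then obtain F where F: "one_fooling_set X Y f F" "card F = fool1 X Y f" by auto
  moreover have "finite F"
    using F(1) sub assms by (auto intro: finite_subset[of _ "X \<times> Y"])
  ultimately show ?thesis using that by blast
qed

theorem corollary3:
  fixes X :: "'x set" and Y :: "'y set" and f :: "'x \<times> 'y \<Rightarrow> nat"
  assumes "finite X" and "finite Y"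
    and "f \<in> X \<times> Y \<rightarrow> {0, 1}"
  shows "ereal_of_enat (NQ X Y f) \<ge> ereal (1 / 2) * log2_ereal (fool1 X Y f) + 1"
proof -
  define A where "A = {enat q |q. \<exists>P. qubit_protocol X Y q P \<and>
     (\<forall>x\<in>X. \<forall>y\<in>Y. 0 < prob_output_1 P q x y \<longleftrightarrow> f (x, y) = 1)}"
  have NQ: "NQ X Y f = Inf A" by (simp add: NQ_def A_def)
  show ?thesis
  \<comment> \<open>In these cases the left side is \<open>\<infinity>\<close> or the right side is
    \<open>- \<infinity>\<close>.\<close>
  proof (cases "A = {} \<or> fool1 X Y f = 0")
    case True
    then show ?thesis
      by (auto simp: NQ Inf_enat_def log2_ereal_def)
  next
    case False
    then have "Inf A \<in> A" by (auto simp: Inf_enat_def intro: LeastI)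
    then obtain q P where q: "NQ X Y f = enat q" and P: "qubit_protocol X Y q P"
      and acc: "\<forall>x\<in>X. \<forall>y\<in>Y. 0 < prob_output_1 P q x y \<longleftrightarrow> f (x, y) = 1"
      unfolding NQ A_def by blast
    obtain F where F: "one_fooling_set X Y f F" "finite F" "card F = fool1 X Y f"
      using fool1_attained assms by blast
    have "1 \<le> q" using P by (simp add: qubit_protocol_def)
    have "fool1 X Y f \<le> 2 ^ (2 * (q - 1))"
      using fooling_set_card_le[OF P acc F(2,1)] F(3)
      by (simp add: power_mult[symmetric] mult.commute)
    then have "log 2 (real (fool1 X Y f)) \<le> real (2 * (q - 1))"
      using False by (intro log2_of_power_le) auto
    \<comment> \<open>Here \<open>1 \<le> q\<close> makes the truncated subtraction
      \<open>q - 1\<close> exact.\<close>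
    then have "1 / 2 * log 2 (real (fool1 X Y f)) + 1 \<le> real q"
      using \<open>1 \<le> q\<close> by (simp add: of_nat_diff)
    then show ?thesis
      using False by (simp add: q log2_ereal_def one_ereal_def)
  qed
qed

end
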